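(* Let $p\ge2$ be a real number and let $m>0$. Then the best possible constants $\lambda_2$ and $\eta_2$ such that the inequalities $$e^{\lambda_2x^p}<\frac{\tanh_p x}{x}<e^{\eta_2x^p}$$ hold for all $x\in(0,m)$ are $\lambda_2=-\dfrac{1}{p+1}$ and $\eta_2=\dfrac{\ln((\tanh_p m)/m)}{m^p}$ respectively. Here "best possible" means that the inequalities hold for all $x\in(0,m)$ with these constants, and that $\lambda_2$ cannot be replaced by any larger constant, nor $\eta_2$ by any smaller constant, so that the respective inequality still holds for all $x\in(0,m)$.
   Context: For real $1<p<\infty$, define $\operatorname{arcsinh}_p:\mathbb{R}\to\mathbb{R}$ by $\operatorname{arcsinh}_p x=\int_0^x\frac{dt}{(1+t^p)^{1/p}}$ for $x\ge0$ and $\operatorname{arcsinh}_p x=-\operatorname{arcsinh}_p(-x)$ for $x<0$. The generalized hyperbolic sine function $\sinh_p$ is the inverse of $\operatorname{arcsinh}_p$. The generalized hyperbolic cosine and tangent functions are $\cosh_p x=\frac{d}{dx}\sinh_p x$ (for $x\geq 0$, $\cosh_p x=(1+\sinh_p^p x)^{1/p}$, where $\sinh_p^p x=(\sinh_p x)^p$) and $\tanh_p x=\frac{\sinh_p x}{\cosh_p x}$. *)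

theory Defs
  imports "HOL-Analysis.Analysis"
begin

definition arcsinh_p :: "real \<Rightarrow> real \<Rightarrow> real" where
  "arcsinh_p p x =
     (if x \<ge> 0 then integral {0..x} (\<lambda>t. 1 / (1 + t powr p) powr (1 / p))
      else - integral {0..-x} (\<lambda>t. 1 / (1 + t powr p) powr (1 / p)))"

text \<open>For \<open>p > 1\<close> the function \<open>arcsinh_p p\<close> is a bijection of the real line (its integrand is
  positive and behaves like \<open>1 / t\<close> at infinity), so \<open>inv\<close> is a genuine two-sided inverse.\<close>

definition sinh_p :: "real \<Rightarrow> real \<Rightarrow> real" where
  "sinh_p p = inv (arcsinh_p p)"

definition cosh_p :: "real \<Rightarrow> real \<Rightarrow> real" where
  "cosh_p p x = deriv (sinh_p p) x"

definition tanh_p :: "real \<Rightarrow> real \<Rightarrow> real" where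
  "tanh_p p x = sinh_p p x / cosh_p p x"

end

theory Submission
  imports Defs
begin

text \<open>
Write \<open>T\<close> for \<open>tanh_p p\<close> and consider \<open>F x = ln (T x / x) / x powr p\<close> on \<open>x > 0\<close>.
Taking logarithms, \<open>exp (k * x powr p) < T x / x\<close> says \<open>k < F x\<close>, and
\<open>T x / x < exp (k * x powr p)\<close> says \<open>F x < k\<close>. So the best constants on the interval from
\<open>0\<close> to \<open>m\<close> are the infimum and the supremum of \<open>F\<close> there, provided that neither is attained. It is
therefore enough that \<open>F\<close> is strictly increasing and tends to \<open>- 1 / (p + 1)\<close> at \<open>0\<close>; the
supremum is then the value \<open>F m\<close>, by continuity.

Both properties of \<open>F\<close> follow from the equation \<open>T' = 1 - T powr p\<close>, together with
\<open>0 < T < 1\<close> and \<open>T \<longrightarrow> 0\<close> at \<open>0\<close>. The equation comes from \<open>s' = (1 + s powr p) powr (1 / p)\<close> for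
\<open>s = sinh_p p\<close>, since \<open>T = s / s'\<close>.

Monotonicity and limit both come from l'Hopital's rule, in its usual form
(\<open>tendsto_divide_of_deriv_ratio\<close>) and in its monotone form
(\<open>strict_mono_on_divide_of_deriv_ratio\<close>): a quotient of functions vanishing at \<open>0\<close> increases if the
quotient of their derivatives does. Two applications reduce \<open>F\<close> to
\<open>N x / D x\<close> with \<open>N x = x * (1 - T x powr p) - T x\<close> and \<open>D x = p * T x * x powr p\<close>, and then to
\<open>N' x / D' x = - 1 / W x\<close>, where, with \<open>Q x = x / T x\<close>,
\<open>W x = Q x powr (p - 1) + p * Q x powr (p - 2) / (1 - T x powr p)\<close>.
A further application shows that \<open>Q\<close> increases from the limit \<open>1\<close>, because
\<open>1 / T' = 1 / (1 - T powr p)\<close> does. As \<open>p \<ge> 2\<close>, both powers of \<open>Q\<close> are monotone, so \<open>W\<close>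
increases from the limit \<open>p + 1\<close>, and the claim on \<open>F\<close> follows.
\<close>

section \<open>L'Hopital's rule for monotonicity and for limits\<close>

text \<open>By Cauchy's mean value theorem on the interval from \<open>0\<close> to \<open>x\<close>, \<open>f x / g x\<close> is
\<open>f' c / g' c\<close> for some \<open>c < x\<close>, hence less than \<open>f' x / g' x\<close>; by the quotient rule this is
positivity of the derivative of \<open>f / g\<close>.\<close>

lemma strict_mono_on_divide_of_deriv_ratio:
  fixes f g f' g' :: "real \<Rightarrow> real"
  assumes f0: "(f \<longlongrightarrow> 0) (at_right 0)" and g0: "(g \<longlongrightarrow> 0) (at_right 0)"
    and df: "\<And>x. x > 0 \<Longrightarrow> (f has_real_derivative f' x) (at x)"
    and dg: "\<And>x. x > 0 \<Longrightarrow> (g has_real_derivative g' x) (at x)"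
    and gpos: "\<And>x. x > 0 \<Longrightarrow> g x > 0" and g'pos: "\<And>x. x > 0 \<Longrightarrow> g' x > 0"
    and mono: "strict_mono_on {0<..} (\<lambda>x. f' x / g' x)"
  shows "strict_mono_on {0<..} (\<lambda>x. f x / g x)"
proof -
  have below: "f x / g x < f' x / g' x" if x: "x > 0" for x
  proof -
    \<comment> \<open>The value at \<open>0\<close> is not prescribed by the limits, so both functions are
      extended by \<open>0\<close> to make them continuous there.\<close>
    let ?F = "\<lambda>u. if u \<le> 0 then 0 else f u" and ?G = "\<lambda>u. if u \<le> 0 then 0 else g u"
    have pos_limit: "((\<lambda>u. if u \<le> 0 then 0 else h u) \<longlongrightarrow> 0) (at 0)"
      if "(h \<longlongrightarrow> 0) (at_right 0)" for h :: "real \<Rightarrow> real"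
    proof (rule filterlim_split_at)
      show "((\<lambda>u. if u \<le> 0 then 0 else h u) \<longlongrightarrow> 0) (at_left 0)"
        by (rule tendsto_eventually) (auto simp: eventually_at_filter)
      show "((\<lambda>u. if u \<le> 0 then 0 else h u) \<longlongrightarrow> 0) (at_right 0)"
        by (rule Lim_transform_eventually[OF that]) (auto simp: eventually_at_filter)
    qed
    have pos_deriv: "((\<lambda>u. if u \<le> 0 then 0 else h u) has_real_derivative d) (at z)"
      if "z > 0" "(h has_real_derivative d) (at z)" for h :: "real \<Rightarrow> real" and d z
      by (rule has_field_derivative_transform_within_open[OF that(2), of "{0<..}"]) (use that in auto)
    have cont: "isCont ?F z" "isCont ?G z" if "0 \<le> z" for z
      using that pos_limit[OF f0] pos_limit[OF g0]
        DERIV_isCont[OF pos_deriv[OF _ df]] DERIV_isCont[OF pos_deriv[OF _ dg]]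
      by (cases "z = 0"; simp add: isCont_def)+
    have "\<exists>c. 0 < c \<and> c < x \<and> (?F x - ?F 0) * g' c = (?G x - ?G 0) * f' c"
      using GMVT'[of 0 x ?F ?G g' f'] x cont pos_deriv df dg by auto
    then obtain c where c: "0 < c" "c < x" "f x * g' c = g x * f' c"
      using x by auto
    then have "f x / g x = f' c / g' c"
      using gpos[OF x] g'pos[OF c(1)] by (simp add: field_simps)
    also have "\<dots> < f' x / g' x"
      using mono c x by (auto simp: strict_mono_on_def)
    finally show ?thesis .
  qed
  show ?thesis
  proof (rule strict_mono_onI)
    fix a b :: real
    assume ab: "a \<in> {0<..}" "b \<in> {0<..}" "a < b"
    show "f a / g a < f b / g b"
    proof (rule DERIV_pos_imp_increasing[OF ab(3)])
      fix x assume "a \<le> x" "x \<le> b"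
      then have x: "x > 0" using ab by auto
      have "((\<lambda>x. f x / g x) has_real_derivative (f' x * g x - f x * g' x) / (g x * g x)) (at x)"
        using DERIV_divide[OF df[OF x] dg[OF x]] gpos[OF x] by simp
      moreover have "f' x * g x - f x * g' x > 0"
        using below[OF x] gpos[OF x] g'pos[OF x] by (simp add: field_simps)
      ultimately show "\<exists>y. ((\<lambda>x. f x / g x) has_real_derivative y) (at x) \<and> 0 < y"
        using gpos[OF x] by (meson divide_pos_pos mult_pos_pos)
    qed
  qed
qed

lemma tendsto_divide_of_deriv_ratio:
  fixes f g f' g' :: "real \<Rightarrow> real"
  assumes f0: "(f \<longlongrightarrow> 0) (at_right 0)" and g0: "(g \<longlongrightarrow> 0) (at_right 0)"
    and df: "\<And>x. x > 0 \<Longrightarrow> (f has_real_derivative f' x) (at x)"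
    and dg: "\<And>x. x > 0 \<Longrightarrow> (g has_real_derivative g' x) (at x)"
    and gpos: "\<And>x. x > 0 \<Longrightarrow> g x > 0" and g'pos: "\<And>x. x > 0 \<Longrightarrow> g' x > 0"
    and lim: "((\<lambda>x. f' x / g' x) \<longlongrightarrow> L) (at_right 0)"
  shows "((\<lambda>x. f x / g x) \<longlongrightarrow> L) (at_right 0)"
proof -
  have ev: "eventually P (at_right 0)" if "\<And>x::real. x > 0 \<Longrightarrow> P x" for P
    using that by (auto simp: eventually_at_filter)
  show ?thesis
    by (rule lhopital_right_0[OF f0 g0 ev ev ev ev lim])
       (simp_all add: df dg less_imp_neq[OF gpos, symmetric] less_imp_neq[OF g'pos, symmetric])
qed

section \<open>Best constants from a monotone logarithmic ratio\<close>

text \<open>With \<open>F x = ln (R x) / x powr p\<close>, strict monotonicity keeps \<open>F\<close> strictly between its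
limit \<open>L\<close> at \<open>0\<close> and its value at \<open>m\<close>. Both bounds are sharp since \<open>F\<close> comes arbitrarily
close to \<open>L\<close> near \<open>0\<close> and, by continuity, to \<open>F m\<close> to the left of \<open>m\<close>.\<close>

lemma best_constants_of_strict_mono:
  fixes R :: "real \<Rightarrow> real" and p L m :: real
  assumes m: "m > 0" and Rpos: "\<And>x. x > 0 \<Longrightarrow> R x > 0"
    and cont: "isCont R m"
    and mono: "strict_mono_on {0<..} (\<lambda>x. ln (R x) / x powr p)"
    and lim: "((\<lambda>x. ln (R x) / x powr p) \<longlongrightarrow> L) (at_right 0)"
  defines "eta \<equiv> ln (R m) / m powr p"
  shows "x \<in> {0<..<m} \<Longrightarrow> exp (L * x powr p) < R x"
    and "x \<in> {0<..<m} \<Longrightarrow> R x < exp (eta * x powr p)"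
    and "lam > L \<Longrightarrow> \<exists>x\<in>{0<..<m}. R x \<le> exp (lam * x powr p)"
    and "e < eta \<Longrightarrow> \<exists>x\<in>{0<..<m}. exp (e * x powr p) \<le> R x"
proof -
  let ?F = "\<lambda>x. ln (R x) / x powr p"
  have less_iff: "exp (k * x powr p) < R x \<longleftrightarrow> k < ?F x" if "x > 0" for k x
  proof -
    have "exp (k * x powr p) < R x \<longleftrightarrow> k * x powr p < ln (R x)"
      using Rpos[OF that] by (metis exp_less_cancel_iff exp_ln)
    then show ?thesis using that by (simp add: field_simps)
  qed
  have gt_iff: "R x < exp (k * x powr p) \<longleftrightarrow> ?F x < k" if "x > 0" for k x
  proof -
    have "R x < exp (k * x powr p) \<longleftrightarrow> ln (R x) < k * x powr p"
      using Rpos[OF that] by (metis exp_less_cancel_iff exp_ln)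
    then show ?thesis using that by (simp add: field_simps)
  qed
  have F_less: "?F a < ?F b" if "0 < a" "a < b" for a b
    using mono that by (auto simp: strict_mono_on_def)
  show "exp (L * x powr p) < R x" if x: "x \<in> {0<..<m}" for x
  proof -
    \<comment> \<open>Passing to the limit only gives a weak inequality; comparing at \<open>x / 2\<close> first makes it
      strict at \<open>x\<close>.\<close>
    have "eventually (\<lambda>u. ?F u \<le> ?F (x / 2)) (at_right 0)"
      by (rule eventually_at_rightI[of 0 "x / 2"]) (use x F_less in \<open>auto intro: less_imp_le\<close>)
    then have "L \<le> ?F (x / 2)"
      by (intro tendsto_upperbound[OF lim]) auto
    also have "\<dots> < ?F x" using x by (intro F_less) auto
    finally show ?thesis using less_iff x by auto
  qed
  show "R x < exp (eta * x powr p)" if x: "x \<in> {0<..<m}" for x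
    using F_less[of x m] gt_iff[of x eta] x by (auto simp: eta_def)
  show "\<exists>x\<in>{0<..<m}. R x \<le> exp (lam * x powr p)" if "lam > L" for lam
  proof -
    have "eventually (\<lambda>u. ?F u < lam) (at_right 0)"
      using order_tendstoD(2)[OF lim that] .
    moreover have "eventually (\<lambda>u. u \<in> {0<..<m}) (at_right 0)"
      by (rule eventually_at_right_real[OF m])
    ultimately have "eventually (\<lambda>u. ?F u < lam \<and> u \<in> {0<..<m}) (at_right 0)"
      by eventually_elim auto
    then obtain u where "?F u < lam" "u \<in> {0<..<m}"
      using eventually_happens' by (metis (mono_tags, lifting) trivial_limit_at_right_real)
    then show ?thesis using gt_iff[of u lam] by (intro bexI[of _ u]) auto
  qed
  show "\<exists>x\<in>{0<..<m}. exp (e * x powr p) \<le> R x" if "e < eta" for e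
  proof -
    have "isCont ?F m"
      using m Rpos[OF m] cont by (intro continuous_intros) auto
    then have "(?F \<longlongrightarrow> eta) (at_left m)"
      unfolding eta_def isCont_def by (rule filterlim_mono) (auto intro: at_le)
    then have "eventually (\<lambda>u. e < ?F u) (at_left m)"
      using that by (rule order_tendstoD(1))
    moreover have "eventually (\<lambda>u. u \<in> {0<..<m}) (at_left m)"
      by (rule eventually_at_left_real[OF m])
    ultimately have "eventually (\<lambda>u. e < ?F u \<and> u \<in> {0<..<m}) (at_left m)"
      by eventually_elim auto
    then obtain u where "e < ?F u" "u \<in> {0<..<m}"
      using eventually_happens' by (metis (mono_tags, lifting) trivial_limit_at_left_real)
    then show ?thesis using less_iff[of u e] by (intro bexI[of _ u]) auto
  qed
qed

section \<open>Solutions of the differential equation of the hyperbolic tangent\<close>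

text \<open>The double reduction by l'Hopital's rule sketched at the beginning: the quotient
\<open>ln (T x / x) / x powr p\<close> has derivative quotient \<open>N / D\<close>, which has derivative quotient
\<open>- 1 / W\<close>. The terms without a factor \<open>x\<close> cancel in \<open>N'\<close>, and this is what makes
\<open>N' / D'\<close> so simple.\<close>

lemma riccati_log_ratio:
  fixes T :: "real \<Rightarrow> real" and p :: real
  assumes p: "p \<ge> 2"
    and dT: "\<And>x. x > 0 \<Longrightarrow> (T has_real_derivative 1 - T x powr p) (at x)"
    and T01: "\<And>x. x > 0 \<Longrightarrow> 0 < T x \<and> T x < 1"
    and T0: "(T \<longlongrightarrow> 0) (at_right 0)"
  shows "strict_mono_on {0<..} (\<lambda>x. ln (T x / x) / x powr p)"
    and "((\<lambda>x. ln (T x / x) / x powr p) \<longlongrightarrow> - 1 / (p + 1)) (at_right 0)"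
proof -
  have Tp: "T x powr p < 1" if "x > 0" for x
    using T01[OF that] p powr_less_mono2[of p "T x" 1] by auto
  have T_less: "T a < T b" if "0 < a" "a < b" for a b
  proof (rule DERIV_pos_imp_increasing[OF that(2)])
    fix x assume "a \<le> x" "x \<le> b"
    then have "x > 0" using that by auto
    then show "\<exists>y. (T has_real_derivative y) (at x) \<and> 0 < y"
      using dT Tp by (intro exI[of _ "1 - T x powr p"]) auto
  qed
  have Tp_less: "T a powr p < T b powr p" if "0 < a" "a < b" for a b
    using T_less[OF that] T01[of a] that p by (intro powr_less_mono2) auto
  have ev: "eventually P (at_right 0)" if "\<And>x::real. x > 0 \<Longrightarrow> P x" for P
    using that by (auto simp: eventually_at_filter)
  have id0: "((\<lambda>x::real. x) \<longlongrightarrow> 0) (at_right 0)"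
    by (intro tendsto_eq_intros) auto
  have powr0: "((\<lambda>x. h x powr q) \<longlongrightarrow> 0) (at_right 0)"
    if "(h \<longlongrightarrow> 0) (at_right 0)" "\<And>x. x > 0 \<Longrightarrow> h x > 0" "q > 0" for h :: "real \<Rightarrow> real" and q
    using tendsto_powr'[OF that(1) tendsto_const[of q]] that ev[of "\<lambda>x. 0 \<le> h x"]
    by (auto intro: less_imp_le)
  have Tp0: "((\<lambda>x. T x powr p) \<longlongrightarrow> 0) (at_right 0)"
    using powr0[OF T0] T01 p by auto
  define Q where "Q = (\<lambda>x. x / T x)"
  \<comment> \<open>The derivative quotient of \<open>x\<close> and \<open>T x\<close> is \<open>1 / (1 - T x powr p)\<close>.\<close>
  have Q_mono: "strict_mono_on {0<..} Q"
    unfolding Q_def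
    by (rule strict_mono_on_divide_of_deriv_ratio[OF id0 T0, where f' = "\<lambda>_. 1" and g' = "\<lambda>x. 1 - T x powr p"])
       (use dT T01 Tp Tp_less in \<open>auto intro!: strict_mono_onI divide_strict_left_mono mult_pos_pos\<close>)
  have dT_lim: "((\<lambda>x. 1 / (1 - T x powr p)) \<longlongrightarrow> 1) (at_right 0)"
    by (rule tendsto_eq_intros Tp0 refl | simp)+
  have Q_lim: "(Q \<longlongrightarrow> 1) (at_right 0)"
    unfolding Q_def
    by (rule tendsto_divide_of_deriv_ratio[OF id0 T0, where f' = "\<lambda>_. 1" and g' = "\<lambda>x. 1 - T x powr p"])
       (use dT T01 Tp in \<open>auto intro: dT_lim\<close>)
  have Q_pos: "Q x > 0" if "x > 0" for x
    using that T01 by (simp add: Q_def)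
  have Q_less: "Q a < Q b" if "0 < a" "a < b" for a b
    using Q_mono that by (auto simp: strict_mono_on_def)
  define N where "N = (\<lambda>x. x * (1 - T x powr p) - T x)"
  define N' where "N' = (\<lambda>x. - p * x * T x powr (p - 1) * (1 - T x powr p))"
  define D where "D = (\<lambda>x. p * T x * x powr p)"
  define D' where "D' = (\<lambda>x. p * (1 - T x powr p) * x powr p + p * T x * (p * x powr (p - 1)))"
  define W where "W = (\<lambda>x. Q x powr (p - 1) + p * Q x powr (p - 2) / (1 - T x powr p))"
  have W_pos: "W x > 0" if "x > 0" for x
    unfolding W_def using Q_pos[OF that] Tp[OF that] p by (intro add_pos_nonneg) auto
  have W_less: "W a < W b" if ab: "0 < a" "a < b" for a b
  proof -
    have "Q a powr (p - 1) < Q b powr (p - 1)"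
      using Q_less[OF ab] Q_pos[of a] ab p by (intro powr_less_mono2) auto
    \<comment> \<open>The assumption \<open>p \<ge> 2\<close> enters here; the inequality is weak because the exponent is \<open>0\<close>
      for \<open>p = 2\<close>.\<close>
    moreover have "Q a powr (p - 2) \<le> Q b powr (p - 2)"
      using Q_less[OF ab] Q_pos[of a] ab p by (intro powr_mono2) auto
    then have "p * Q a powr (p - 2) / (1 - T a powr p) \<le> p * Q b powr (p - 2) / (1 - T b powr p)"
      using Tp_less[OF ab] Tp[of b] ab p by (intro frac_le mult_left_mono) auto
    ultimately show ?thesis unfolding W_def by linarith
  qed
  have ratio: "N' x / D' x = - 1 / W x" if x: "x > 0" for x
  proof -
    let ?u = "1 - T x powr p"
    have u: "?u > 0" and t: "T x > 0" using Tp[OF x] T01[OF x] by auto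
    have q1: "Q x powr (p - 1) = x powr (p - 1) / T x powr (p - 1)"
      using x t by (simp add: Q_def powr_divide)
    have q2: "Q x powr (p - 2) = x powr (p - 1) * T x / (x * T x powr (p - 1))"
    proof -
      have "Q x powr (p - 2) = Q x powr ((p - 1) - 1)" by (simp add: algebra_simps)
      also have "\<dots> = Q x powr (p - 1) / Q x" using Q_pos[OF x] by (simp only: powr_diff powr_one)
      also have "\<dots> = x powr (p - 1) * T x / (x * T x powr (p - 1))"
        unfolding q1 by (simp add: Q_def)
      finally show ?thesis .
    qed
    have xp: "x powr p = x * x powr (p - 1)" using x by (simp add: powr_mult_base)
    have "D' x = p * x * T x powr (p - 1) * ?u * W x"
      unfolding W_def q1 q2 D'_def xp using u t x by (simp add: field_simps)
    then show ?thesis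
      using W_pos[OF x] u t x p by (simp add: N'_def)
  qed
  have N0: "(N \<longlongrightarrow> 0) (at_right 0)"
    unfolding N_def by (rule tendsto_eq_intros id0 Tp0 T0 refl | simp)+
  have xp0: "((\<lambda>x::real. x powr p) \<longlongrightarrow> 0) (at_right 0)"
    using powr0[OF id0] p by auto
  have D0: "(D \<longlongrightarrow> 0) (at_right 0)"
    unfolding D_def by (rule tendsto_eq_intros xp0 T0 refl | simp)+
  have dxp: "((\<lambda>x. x powr p) has_real_derivative p * x powr (p - 1)) (at x)" if "x > 0" for x
    using has_real_derivative_powr[OF that, of p] .
  have dTp: "((\<lambda>x. T x powr p) has_real_derivative p * T x powr (p - 1) * (1 - T x powr p)) (at x)" if "x > 0" for x
    using DERIV_fun_powr[OF dT[OF that], of p] T01[OF that] by simp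
  have dN: "(N has_real_derivative N' x) (at x)" if "x > 0" for x
    unfolding N_def N'_def
    by (rule derivative_eq_intros dTp[OF that] dT[OF that] refl)+ (simp add: algebra_simps)
  have dD: "(D has_real_derivative D' x) (at x)" if "x > 0" for x
    unfolding D_def D'_def
    by (rule derivative_eq_intros dxp[OF that] dT[OF that] refl)+ (simp add: algebra_simps)
  have Dpos: "D x > 0" if "x > 0" for x
    unfolding D_def using that T01[OF that] p by auto
  have D'pos: "D' x > 0" if "x > 0" for x
    unfolding D'_def using that T01[OF that] Tp[OF that] p by (intro add_pos_pos mult_pos_pos) auto
  have ND'_mono: "strict_mono_on {0<..} (\<lambda>x. N' x / D' x)"
  proof (rule strict_mono_onI)
    fix a b :: real assume "a \<in> {0<..}" "b \<in> {0<..}" "a < b"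
    then show "N' a / D' a < N' b / D' b"
      using ratio W_less[of a b] W_pos[of a] by (simp add: frac_less2)
  qed
  have W_lim: "(W \<longlongrightarrow> p + 1) (at_right 0)"
    unfolding W_def by (rule tendsto_eq_intros Q_lim Tp0 refl | simp)+
  have ND'_lim: "((\<lambda>x. N' x / D' x) \<longlongrightarrow> - 1 / (p + 1)) (at_right 0)"
  proof (rule Lim_transform_eventually)
    show "((\<lambda>x. - 1 / W x) \<longlongrightarrow> - 1 / (p + 1)) (at_right 0)"
      using p by (intro tendsto_intros W_lim) auto
    show "eventually (\<lambda>x. - 1 / W x = N' x / D' x) (at_right 0)"
      by (rule ev) (simp add: ratio)
  qed
  note ND_mono = strict_mono_on_divide_of_deriv_ratio[OF N0 D0 dN dD Dpos D'pos ND'_mono]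
  have ND_lim: "((\<lambda>x. N x / D x) \<longlongrightarrow> - 1 / (p + 1)) (at_right 0)"
    by (rule tendsto_divide_of_deriv_ratio[OF N0 D0 dN dD Dpos D'pos ND'_lim])
  have log0: "((\<lambda>x. ln (T x / x)) \<longlongrightarrow> 0) (at_right 0)"
  proof -
    have "((\<lambda>x. - ln (Q x)) \<longlongrightarrow> - ln 1) (at_right 0)"
      by (intro tendsto_intros Q_lim) auto
    then have "((\<lambda>x. - ln (Q x)) \<longlongrightarrow> 0) (at_right 0)" by simp
    then show ?thesis
      by (rule Lim_transform_eventually) (rule ev, use T01 in \<open>simp add: Q_def ln_div\<close>)
  qed
  have dlog: "((\<lambda>x. ln (T x / x)) has_real_derivative (1 - T x powr p) / T x - 1 / x) (at x)"
    if "x > 0" for x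
    by (rule derivative_eq_intros dT[OF that] refl | use that T01[OF that] in \<open>simp add: field_simps\<close>)+
  have log_ratio: "((1 - T x powr p) / T x - 1 / x) / (p * x powr (p - 1)) = N x / D x" if x: "x > 0" for x
  proof -
    have "x powr p = x * x powr (p - 1)" using x by (simp add: powr_mult_base)
    then show ?thesis
      using x T01[OF x] p by (simp add: N_def D_def field_simps)
  qed
  have log_mono: "strict_mono_on {0<..} (\<lambda>x. ((1 - T x powr p) / T x - 1 / x) / (p * x powr (p - 1)))"
    using ND_mono by (auto simp: strict_mono_on_def log_ratio)
  have log_lim: "((\<lambda>x. ((1 - T x powr p) / T x - 1 / x) / (p * x powr (p - 1))) \<longlongrightarrow> - 1 / (p + 1)) (at_right 0)"
    by (rule Lim_transform_eventually[OF ND_lim]) (rule ev, simp_all add: log_ratio)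
  show "strict_mono_on {0<..} (\<lambda>x. ln (T x / x) / x powr p)"
    by (rule strict_mono_on_divide_of_deriv_ratio[OF log0 xp0 dlog dxp _ _ log_mono]) (use p in auto)
  show "((\<lambda>x. ln (T x / x) / x powr p) \<longlongrightarrow> - 1 / (p + 1)) (at_right 0)"
    by (rule tendsto_divide_of_deriv_ratio[OF log0 xp0 dlog dxp _ _ log_lim]) (use p in auto)
qed

section \<open>The generalized inverse hyperbolic sine\<close>

text \<open>Bounds the integrand of \<open>arcsinh_p\<close> from below by \<open>1 / (1 + t)\<close>.\<close>

lemma one_plus_powr_le:
  fixes t p :: real
  assumes "t \<ge> 0" "p \<ge> 1"
  shows "1 + t powr p \<le> (1 + t) powr p"
proof -
  have "1 + t powr p = 1 + t * t powr (p - 1)"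
    using assms by (simp add: powr_mult_base)
  also have "\<dots> \<le> 1 * (1 + t) powr (p - 1) + t * (1 + t) powr (p - 1)"
    using assms powr_mono2[of "p - 1" t "1 + t"] ge_one_powr_ge_zero[of "1 + t" "p - 1"]
    by (intro add_mono mult_left_mono) auto
  also have "\<dots> = (1 + t) powr p"
    using assms powr_mult_base[of "1 + t" "p - 1"] by (simp add: algebra_simps)
  finally show ?thesis .
qed

lemma arcsinh_p_integrand_continuous:
  assumes "p > 0"
  shows "continuous_on {0..x} (\<lambda>t::real. 1 / (1 + t powr p) powr (1 / p))"
proof -
  have "1 + t powr p > 0" for t :: real
    by (simp add: add_pos_nonneg)
  then show ?thesis
    using assms by (intro continuous_intros continuous_on_powr') (auto simp: less_imp_neq[symmetric])
qed

lemma arcsinh_p_has_derivative: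
  assumes "p > 0" "y > 0"
  shows "(arcsinh_p p has_real_derivative 1 / (1 + y powr p) powr (1 / p)) (at y)"
proof -
  let ?g = "\<lambda>t::real. 1 / (1 + t powr p) powr (1 / p)"
  have "((\<lambda>x. integral {0..x} ?g) has_real_derivative ?g y) (at y within {0..y + 1})"
    using assms by (intro integral_has_real_derivative arcsinh_p_integrand_continuous) auto
  then have "((\<lambda>x. integral {0..x} ?g) has_real_derivative ?g y) (at y)"
    using assms at_within_Icc_at[of 0 y "y + 1"] by simp
  then show ?thesis
    by (rule has_field_derivative_transform_within_open[of _ _ _ "{0<..}"])
       (use assms in \<open>auto simp: arcsinh_p_def\<close>)
qed

lemma arcsinh_p_continuous:
  assumes "p > 0"
  shows "continuous_on {0..x} (arcsinh_p p)"
proof -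
  have "continuous_on {0..x} (\<lambda>x. integral {0..x} (\<lambda>t::real. 1 / (1 + t powr p) powr (1 / p)))"
    using assms by (intro indefinite_integral_continuous_1 integrable_continuous_interval
      arcsinh_p_integrand_continuous)
  then show ?thesis
    by (rule continuous_on_eq) (auto simp: arcsinh_p_def)
qed

lemma arcsinh_p_minus: "arcsinh_p p (- x) = - arcsinh_p p x"
  by (auto simp: arcsinh_p_def)

text \<open>Monotonicity is needed on the whole line, not just for positive arguments: \<open>sinh_p\<close> is defined
by choosing some preimage, which is unique only if the function is injective everywhere.\<close>

lemma strict_mono_arcsinh_p:
  assumes "p > 0"
  shows "strict_mono (arcsinh_p p)"
proof -
  have incr: "arcsinh_p p a < arcsinh_p p b" if "0 \<le> a" "a < b" for a b
  proof (rule DERIV_pos_imp_increasing_open[OF that(2)])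
    fix x assume "a < x" "x < b"
    then have "x > 0" "1 + x powr p > 0" using that by (auto simp: add_pos_nonneg)
    then show "\<exists>y. (arcsinh_p p has_real_derivative y) (at x) \<and> 0 < y"
      using arcsinh_p_has_derivative[OF assms] by (intro exI[of _ "1 / (1 + x powr p) powr (1 / p)"]) auto
  next
    show "continuous_on {a..b} (arcsinh_p p)"
      by (rule continuous_on_subset[OF arcsinh_p_continuous[OF assms, of b]]) (use that in auto)
  qed
  have zero: "arcsinh_p p 0 = 0" by (simp add: arcsinh_p_def)
  show ?thesis
  proof (rule strict_monoI)
    fix a b :: real assume ab: "a < b"
    consider "0 \<le> a" | "a < 0" "0 \<le> b" | "b < 0" by linarith
    then show "arcsinh_p p a < arcsinh_p p b"
    proof cases
      case 1
      then show ?thesis using incr ab by auto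
    next
      case 2
      then have "arcsinh_p p a < 0"
        using incr[of 0 "- a"] zero by (simp add: arcsinh_p_minus)
      moreover have "0 \<le> arcsinh_p p b"
        using incr[of 0 b] zero 2 by (cases "b = 0") auto
      ultimately show ?thesis by linarith
    next
      case 3
      then show ?thesis using incr[of "- b" "- a"] ab by (simp add: arcsinh_p_minus)
    qed
  qed
qed

text \<open>This single bound serves two purposes: \<open>arcsinh_p\<close> is unbounded, hence onto, and its inverse
is at most \<open>exp x - 1\<close>, hence tends to \<open>0\<close> at \<open>0\<close>.\<close>

lemma arcsinh_p_ge_ln:
  assumes "p \<ge> 1" "y \<ge> 0"
  shows "ln (1 + y) \<le> arcsinh_p p y"
proof -
  have ftc: "((\<lambda>t. 1 / (1 + t)) has_integral ln (1 + y) - ln (1 + 0)) {0..y}"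
    using assms
    by (intro fundamental_theorem_of_calculus)
       (auto intro!: derivative_eq_intros simp flip: has_real_derivative_iff_has_vector_derivative)
  have bound: "1 / (1 + t) \<le> 1 / (1 + t powr p) powr (1 / p)" if "t \<ge> 0" for t
  proof -
    have pos: "1 + t powr p > 0" by (simp add: add_pos_nonneg)
    have "(1 + t powr p) powr (1 / p) \<le> ((1 + t) powr p) powr (1 / p)"
      using assms that pos by (intro powr_mono2 one_plus_powr_le) auto
    also have "\<dots> = 1 + t" using assms that by (simp add: powr_powr)
    finally show ?thesis using pos that by (intro divide_left_mono) auto
  qed
  have "integral {0..y} (\<lambda>t. 1 / (1 + t)) \<le> integral {0..y} (\<lambda>t. 1 / (1 + t powr p) powr (1 / p))"
    using assms ftc bound
    by (intro integral_le has_integral_integrable[OF ftc] integrable_continuous_interval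
        arcsinh_p_integrand_continuous) auto
  then show ?thesis
    using assms integral_unique[OF ftc] by (simp add: arcsinh_p_def)
qed

section \<open>The generalized hyperbolic sine and tangent\<close>

lemma sinh_p_arcsinh_p: "p > 0 \<Longrightarrow> sinh_p p (arcsinh_p p y) = y"
  unfolding sinh_p_def by (intro inv_f_f strict_mono_imp_inj_on strict_mono_arcsinh_p)

text \<open>The logarithmic bound places a preimage of \<open>x\<close> between \<open>0\<close> and \<open>exp x\<close>, by the
intermediate value theorem; injectivity identifies it with \<open>sinh_p p x\<close>.\<close>

lemma sinh_p_on_positive:
  assumes "p \<ge> 1" "x > 0"
  shows "sinh_p p x > 0" "arcsinh_p p (sinh_p p x) = x" "sinh_p p x \<le> exp x - 1"
proof -
  have "\<exists>y\<ge>0. y \<le> exp x \<and> arcsinh_p p y = x"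
  proof (rule IVT')
    show "arcsinh_p p 0 \<le> x" using assms by (simp add: arcsinh_p_def)
    have "x \<le> ln (1 + exp x)" by (simp add: ln_ge_iff add_pos_pos)
    then show "x \<le> arcsinh_p p (exp x)" using arcsinh_p_ge_ln[of p "exp x"] assms by simp
  qed (use assms arcsinh_p_continuous in auto)
  then obtain y where y: "y \<ge> 0" "arcsinh_p p y = x" by auto
  have "y \<noteq> 0" using y assms by (auto simp: arcsinh_p_def)
  have s: "sinh_p p x = y" using y sinh_p_arcsinh_p[of p y] assms by auto
  show "sinh_p p x > 0" "arcsinh_p p (sinh_p p x) = x" using s y \<open>y \<noteq> 0\<close> by auto
  have "ln (1 + y) \<le> x" using arcsinh_p_ge_ln[of p y] y assms by simp
  then show "sinh_p p x \<le> exp x - 1"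
    using s y exp_le_cancel_iff[of "ln (1 + y)" x] by (simp del: exp_le_cancel_iff)
qed

lemma sinh_p_has_derivative:
  assumes "p \<ge> 1" "x > 0"
  shows "(sinh_p p has_real_derivative (1 + sinh_p p x powr p) powr (1 / p)) (at x)"
proof -
  let ?s = "sinh_p p x"
  have s: "?s > 0" "arcsinh_p p ?s = x" using sinh_p_on_positive assms by auto
  have pos: "1 + ?s powr p > 0" by (simp add: add_pos_nonneg)
  have "(sinh_p p has_real_derivative (1 + ?s powr p) powr (1 / p)) (at (arcsinh_p p ?s))"
    unfolding has_field_derivative_def
  proof (rule has_derivative_inverse_strong[of "{0<..}" ?s "arcsinh_p p" "sinh_p p"])
    show "(arcsinh_p p has_derivative (*) (1 / (1 + ?s powr p) powr (1 / p))) (at ?s)"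
      using assms s arcsinh_p_has_derivative[of p ?s] by (simp add: has_field_derivative_def)
    show "continuous_on {0<..} (arcsinh_p p)"
      using assms arcsinh_p_has_derivative[of p]
      by (intro continuous_at_imp_continuous_on) (auto intro: DERIV_isCont)
  qed (use s pos assms sinh_p_arcsinh_p in auto)
  then show ?thesis using s by simp
qed

lemma tanh_p_eq:
  assumes "p \<ge> 1" "x > 0"
  shows "tanh_p p x = sinh_p p x / (1 + sinh_p p x powr p) powr (1 / p)"
  using DERIV_imp_deriv[OF sinh_p_has_derivative[OF assms]] by (simp add: tanh_p_def cosh_p_def)

lemma tanh_p_powr:
  assumes "p \<ge> 1" "x > 0"
  shows "tanh_p p x powr p = 1 - 1 / (1 + sinh_p p x powr p)"
proof -
  let ?s = "sinh_p p x"
  have s: "?s > 0" "1 + ?s powr p > 0" using sinh_p_on_positive assms by (auto simp: add_pos_nonneg)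
  then have "tanh_p p x powr p = ?s powr p / ((1 + ?s powr p) powr (1 / p)) powr p"
    using assms by (simp add: tanh_p_eq powr_divide)
  also have "\<dots> = ?s powr p / (1 + ?s powr p)"
    using assms s by (simp add: powr_powr)
  finally show ?thesis using s by (simp add: field_simps)
qed

lemma tanh_p_bounds:
  assumes "p \<ge> 1" "x > 0"
  shows "0 < tanh_p p x" "tanh_p p x < 1" "tanh_p p x \<le> sinh_p p x"
proof -
  let ?s = "sinh_p p x"
  have s: "?s > 0" "1 + ?s powr p > 0" using sinh_p_on_positive assms by (auto simp: add_pos_nonneg)
  show pos: "0 < tanh_p p x" using s by (simp add: tanh_p_eq[OF assms])
  show "tanh_p p x < 1"
  proof (rule ccontr)
    assume "\<not> tanh_p p x < 1"
    then have "tanh_p p x powr p \<ge> 1" using assms by (intro ge_one_powr_ge_zero) auto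
    then show False using s by (simp add: tanh_p_powr[OF assms])
  qed
  have "(1 + ?s powr p) powr (1 / p) \<ge> 1"
    using assms by (intro ge_one_powr_ge_zero) auto
  then show "tanh_p p x \<le> ?s" using s divide_left_mono[of 1 "(1 + ?s powr p) powr (1 / p)" ?s] by (simp add: tanh_p_eq[OF assms])
qed

text \<open>The function \<open>s / (1 + s powr p) powr (1 / p)\<close> has derivative
\<open>(1 + s powr p) powr (- 1 / p - 1)\<close> in \<open>s\<close>. At \<open>s = sinh_p p x\<close>, the chain rule multiplies this by
\<open>(1 + s powr p) powr (1 / p)\<close>, which leaves \<open>1 / (1 + s powr p) = 1 - tanh_p p x powr p\<close>.\<close>

lemma tanh_p_has_derivative:
  assumes "p \<ge> 1" "x > 0"
  shows "(tanh_p p has_real_derivative 1 - tanh_p p x powr p) (at x)"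
proof -
  let ?s = "sinh_p p x"
  let ?c = "(1 + ?s powr p) powr (1 / p)"
  have s: "?s > 0" "1 + ?s powr p > 0" using sinh_p_on_positive assms by (auto simp: add_pos_nonneg)
  have dw: "((\<lambda>s. 1 + s powr p) has_real_derivative p * ?s powr (p - 1)) (at ?s)"
    using DERIV_add[OF DERIV_const has_real_derivative_powr[OF s(1), of p], of 1] by simp
  have "((\<lambda>s. s * (1 + s powr p) powr (- 1 / p)) has_real_derivative
      1 * (1 + ?s powr p) powr (- 1 / p) +
      (- 1 / p) * (1 + ?s powr p) powr (- 1 / p - 1) * (p * ?s powr (p - 1)) * ?s) (at ?s)"
    using DERIV_mult[OF DERIV_ident DERIV_fun_powr[OF dw s(2), of "- 1 / p"]]
    by simp
  also have "1 * (1 + ?s powr p) powr (- 1 / p) +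
      (- 1 / p) * (1 + ?s powr p) powr (- 1 / p - 1) * (p * ?s powr (p - 1)) * ?s
      = 1 / (?c * (1 + ?s powr p))"
  proof -
    have neg_root: "(1 + ?s powr p) powr (- 1 / p) = 1 / ?c"
      using s by (simp add: powr_minus_divide)
    have neg_root': "(1 + ?s powr p) powr (- 1 / p - 1) = 1 / (?c * (1 + ?s powr p))"
      using s by (simp add: powr_diff powr_minus_divide)
    have powr_p: "?s powr (p - 1) * ?s = ?s powr p"
      using s powr_mult_base[of ?s "p - 1"] by (simp add: mult.commute)
    have "p \<noteq> 0" using assms by simp
    then show ?thesis
      unfolding neg_root neg_root' using s powr_p by (simp add: divide_simps)
  qed
  finally have "((\<lambda>x. sinh_p p x * (1 + sinh_p p x powr p) powr (- 1 / p)) has_real_derivative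
      1 / (?c * (1 + ?s powr p)) * ?c) (at x)"
    by (rule DERIV_chain2) (rule sinh_p_has_derivative[OF assms])
  then have "(tanh_p p has_real_derivative 1 / (?c * (1 + ?s powr p)) * ?c) (at x)"
    by (rule has_field_derivative_transform_within_open[of _ _ _ "{0<..}"])
       (use assms in \<open>auto simp: tanh_p_eq powr_minus_divide\<close>)
  moreover have "1 / (?c * (1 + ?s powr p)) * ?c = 1 - tanh_p p x powr p"
    using s by (simp add: tanh_p_powr[OF assms])
  ultimately show ?thesis by simp
qed

lemma tanh_p_tendsto_0:
  assumes "p \<ge> 1"
  shows "(tanh_p p \<longlongrightarrow> 0) (at_right 0)"
proof (rule tendsto_sandwich)
  show "eventually (\<lambda>x. 0 \<le> tanh_p p x) (at_right 0)"
    using tanh_p_bounds[OF assms]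
    by (auto simp: eventually_at_filter intro!: always_eventually less_imp_le)
  show "eventually (\<lambda>x. tanh_p p x \<le> exp x - 1) (at_right 0)"
    using tanh_p_bounds(3)[OF assms] sinh_p_on_positive(3)[OF assms]
    by (auto simp: eventually_at_filter intro!: always_eventually intro: order_trans)
  show "((\<lambda>x::real. exp x - 1) \<longlongrightarrow> 0) (at_right 0)"
    by (intro tendsto_eq_intros | simp)+
qed simp

section \<open>The best constants for the generalized hyperbolic tangent\<close>

theorem theorem3p6:
  fixes p m lam2 eta2 :: real
  assumes "p \<ge> 2" and "m > 0"
    and "lam2 = - 1 / (p + 1)"
    and "eta2 = ln (tanh_p p m / m) / m powr p"
  shows "(\<forall>x\<in>{0<..<m}. exp (lam2 * x powr p) < tanh_p p x / x \<and>
                          tanh_p p x / x < exp (eta2 * x powr p)) \<and>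
         (\<forall>lam>lam2. \<not> (\<forall>x\<in>{0<..<m}. exp (lam * x powr p) < tanh_p p x / x)) \<and>
         (\<forall>eta<eta2. \<not> (\<forall>x\<in>{0<..<m}. tanh_p p x / x < exp (eta * x powr p)))"
proof -
  have p: "p \<ge> 1" using assms by simp
  note log_ratio = riccati_log_ratio[OF assms(1) tanh_p_has_derivative[OF p] _ tanh_p_tendsto_0[OF p]]
  have pos: "tanh_p p x / x > 0" if "x > 0" for x
    using tanh_p_bounds[OF p that] that by simp
  have cont: "isCont (\<lambda>x. tanh_p p x / x) m"
    using DERIV_isCont[OF tanh_p_has_derivative[OF p assms(2)]] assms(2)
    by (intro continuous_intros) auto
  note best = best_constants_of_strict_mono[where R = "\<lambda>x. tanh_p p x / x", OF assms(2) pos cont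
      log_ratio, folded assms(3,4)]
  show ?thesis
    using best tanh_p_bounds[OF p] by (meson not_less)
qed

end
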